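(* Let $\mathsf{k}$ be a field of characteristic zero and let $f,\omega\in\mathsf{k}[x]$ be such that $\int_\gamma\omega=0$ for some simple cycle $\gamma\in H_0(\{f=0\},\mathbb{Z})$. Then there exists a polynomial $g\in\mathsf{k}[x]$ such that: (1) $\deg(g)<\deg(f)$; (2) the degree of each irreducible factor of $g$ over $\mathsf{k}$ divides the degree of some irreducible factor of $f$ over $\mathsf{k}$; (3) $f\mid g\circ\omega$, the morphism $\alpha_\omega:\{f=0\}\to\{g=0\}$, $\alpha_\omega(x)=\omega(x)$, defined over $\mathsf{k}$, is surjective, and $(\alpha_\omega)_*(\gamma)=0$.
   Context: For a nonzero polynomial $f\in\mathsf{k}[x]$, $\{f=0\}$ denotes the finite set of roots of $f$ in an algebraic closure $\bar{\mathsf{k}}$ of $\mathsf{k}$. For a finite set $M=\{x_1,\dots,x_d\}$, $H_0(M,\mathbb{Z})=\{\sum n_i x_i: n_i\in\mathbb{Z},\ \sum n_i=0\}$ is the reduced homology group. A simple cycle is an element $x_i-x_j$ with $x_i\neq x_j$ in $M$. For $\gamma=x_i-x_j\in H_0(\{f=0\},\mathbb{Z})$ and $\omega\in\mathsf{k}[x]$ one puts $\int_\gamma\omega=\omega(x_i)-\omega(x_j)$. If $f\mid g\circ\omega$, then $x\mapsto\omega(x)$ maps roots of $f$ to roots of $g$, which defines $\alpha_\omega$; $(\alpha_\omega)_*:H_0(\{f=0\},\mathbb{Z})\to H_0(\{g=0\},\mathbb{Z})$ is the induced map $\sum n_i x_i\mapsto\sum n_i\,\omega(x_i)$ (formal sums).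 *)

theory Defs
  imports "HOL-Algebra.Algebraic_Closure_Type" "HOL-Library.Poly_Mapping"
begin

definition root_set :: "'a::field poly \<Rightarrow> 'a alg_closure set" where
  "root_set f = {x. poly (map_poly to_ac f) x = 0}"

text \<open>
  The formal sum \<open>\<Sum> n\<^sub>i x\<^sub>i\<close> is the finitely supported function sending \<open>x\<^sub>i\<close> to \<open>n\<^sub>i\<close>;
  in particular \<open>frag_of x - frag_of y\<close> is the formal difference of two points, not the
  difference of two field elements.
\<close>

definition reduced_H0 :: "'b set \<Rightarrow> ('b \<Rightarrow>\<^sub>0 int) set" where
  "reduced_H0 M = {\<gamma>. Poly_Mapping.keys \<gamma> \<subseteq> M \<and>
     (\<Sum>x\<in>Poly_Mapping.keys \<gamma>. Poly_Mapping.lookup \<gamma> x) = 0}"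

definition simple_cycles :: "'b set \<Rightarrow> ('b \<Rightarrow>\<^sub>0 int) set" where
  "simple_cycles M = {\<gamma> \<in> reduced_H0 M.
     \<exists>x\<in>M. \<exists>y\<in>M. x \<noteq> y \<and> \<gamma> = frag_of x - frag_of y}"

definition root_map :: "'a::field poly \<Rightarrow> 'a alg_closure \<Rightarrow> 'a alg_closure" where
  "root_map \<omega> x = poly (map_poly to_ac \<omega>) x"

text \<open>
  The integral is extended linearly to all formal sums; its value on a simple cycle is given
  by \<open>cycle_integral_simple\<close> below.
\<close>

definition cycle_integral :: "('a::field alg_closure \<Rightarrow>\<^sub>0 int) \<Rightarrow> 'a poly \<Rightarrow> 'a alg_closure" where
  "cycle_integral \<gamma> \<omega> =
     (\<Sum>x\<in>Poly_Mapping.keys \<gamma>. of_int (Poly_Mapping.lookup \<gamma> x) * root_map \<omega> x)"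

definition push_cycle :: "('b \<Rightarrow> 'c) \<Rightarrow> ('b \<Rightarrow>\<^sub>0 int) \<Rightarrow> ('c \<Rightarrow>\<^sub>0 int)" where
  "push_cycle h = frag_extend (\<lambda>x. frag_of (h x))"

text \<open>
  A map between finite sets of points of the affine line over the algebraic closure is a
  morphism defined over the base field iff it is the restriction of a polynomial map with
  coefficients in the base field.
\<close>

definition morphism_over_base ::
    "'a::field alg_closure set \<Rightarrow> 'a alg_closure set \<Rightarrow> ('a alg_closure \<Rightarrow> 'a alg_closure) \<Rightarrow> bool" where
  "morphism_over_base M N h \<longleftrightarrow>
     h ` M \<subseteq> N \<and> (\<exists>p::'a poly. \<forall>x\<in>M. h x = poly (map_poly to_ac p) x)"

lemma finite_root_set: "f \<noteq> 0 \<Longrightarrow> finite (root_set f)"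
  unfolding root_set_def by (rule poly_roots_finite) (simp add: map_poly_eq_0_iff)

lemma simple_cycle_in_reduced_H0:
  assumes "x \<in> M" "y \<in> M" "x \<noteq> y"
  shows "frag_of x - frag_of y \<in> reduced_H0 M"
proof -
  have k: "Poly_Mapping.keys (frag_of x - frag_of y) = {x, y}"
    using assms by (auto simp: in_keys_iff lookup_minus lookup_single when_def
        split: if_splits)
  show ?thesis using assms unfolding reduced_H0_def mem_Collect_eq k
    by (auto simp: lookup_minus lookup_single when_def)
qed

lemma simple_cycles_eq:
  "simple_cycles M = {frag_of x - frag_of y |x y. x \<in> M \<and> y \<in> M \<and> x \<noteq> y}"
proof (intro equalityI subsetI)
  fix \<gamma> assume "\<gamma> \<in> simple_cycles M"
  then show "\<gamma> \<in> {frag_of x - frag_of y |x y. x \<in> M \<and> y \<in> M \<and> x \<noteq> y}"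
    unfolding simple_cycles_def by blast
next
  fix \<gamma> assume "\<gamma> \<in> {frag_of x - frag_of y |x y. x \<in> M \<and> y \<in> M \<and> x \<noteq> y}"
  then obtain x y where xy: "x \<in> M" "y \<in> M" "x \<noteq> y"
    and \<gamma>: "\<gamma> = frag_of x - frag_of y"
    by (elim CollectE exE conjE)
  show "\<gamma> \<in> simple_cycles M"
    unfolding simple_cycles_def \<gamma>
    by (intro CollectI conjI bexI[of _ x] bexI[of _ y] simple_cycle_in_reduced_H0 refl xy)
qed

lemma cycle_integral_simple:
  assumes "x \<noteq> y"
  shows "cycle_integral (frag_of x - frag_of y) \<omega> =
           poly (map_poly to_ac \<omega>) x - poly (map_poly to_ac \<omega>) y"
proof -
  have k: "Poly_Mapping.keys (frag_of x - frag_of y) = {x, y}"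
    using assms by (auto simp: in_keys_iff lookup_minus lookup_single when_def
        split: if_splits)
  show ?thesis using assms unfolding cycle_integral_def k
    by (auto simp: lookup_minus lookup_single when_def root_map_def)
qed

lemma push_cycle_simple:
  "push_cycle h (frag_of x - frag_of y) = frag_of (h x) - frag_of (h y)"
  unfolding push_cycle_def by (simp add: frag_extend_diff)

lemma root_map_pcompose: "root_map (pcompose g \<omega>) x = root_map g (root_map \<omega> x)"
proof -
  have add: "map_poly to_ac (p + q) = map_poly to_ac p + map_poly to_ac q" for p q :: "'a poly"
    by (rule poly_eqI) (simp add: coeff_map_poly)
  have mult: "map_poly to_ac (p * q) = map_poly to_ac p * map_poly to_ac q" for p q :: "'a poly"
    by (rule poly_eqI) (simp add: coeff_map_poly coeff_mult to_ac_sum)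
  show ?thesis unfolding root_map_def
    by (induction g) (simp_all add: pcompose_pCons add mult map_poly_pCons)
qed

lemma morphism_root_map:
  assumes "f dvd pcompose g \<omega>"
  shows "morphism_over_base (root_set f) (root_set g) (root_map \<omega>)"
proof -
  obtain h where h: "pcompose g \<omega> = f * h" using assms by (elim dvdE)
  have mult: "map_poly to_ac (f * h) = map_poly to_ac f * map_poly to_ac h"
    by (rule poly_eqI) (simp add: coeff_map_poly coeff_mult to_ac_sum)
  have "root_map g (root_map \<omega> x) = 0" if "x \<in> root_set f" for x
    using that unfolding root_map_pcompose [symmetric] h
    by (simp add: root_map_def mult root_set_def)
  then show ?thesis
    unfolding morphism_over_base_def by (auto simp: root_set_def root_map_def)
qed

end

theory Submission
  imports Defs "Jordan_Normal_Form.Char_Poly"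
begin

text \<open>
  For an irreducible factor \<open>a\<close> of \<open>f\<close>, multiplication by \<open>\<omega>\<close> on \<open>k[x]/(a)\<close> is a matrix
  over \<open>k\<close> whose eigenvalues are values of \<open>\<omega>\<close> at roots of \<open>a\<close>. Every irreducible factor of
  its characteristic polynomial therefore vanishes at all of these values, so that the
  characteristic polynomial is a power of a single irreducible \<open>g\<^sub>a\<close>, with roots \<open>\<omega>({a = 0})\<close> and
  degree dividing \<open>deg a\<close>. Take \<open>g\<close> to be the product of the distinct \<open>g\<^sub>a\<close>, each raised to
  the largest multiplicity in \<open>f\<close> of a factor \<open>a\<close> giving rise to it. If \<open>\<omega>\<close> identifies two roots
  of \<open>f\<close>, then either they belong to the same \<open>a\<close> and, by separability, \<open>deg g\<^sub>a < deg a\<close>, or they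
  belong to two factors sharing the same \<open>g\<^sub>a\<close>; in both cases the degree drops.
\<close>

section \<open>Evaluation of polynomials over the algebraic closure\<close>

interpretation to_ac: field_hom to_ac
  by unfold_locales simp_all
interpretation to_ac_poly: map_poly_inj_idom_hom to_ac ..

lemma root_map_0 [simp]: "root_map 0 x = 0"
  and root_map_1 [simp]: "root_map 1 x = 1"
  and root_map_add: "root_map (p + q) x = root_map p x + root_map q x"
  and root_map_mult: "root_map (p * q) x = root_map p x * root_map q x"
  by (simp_all add: root_map_def to_ac_poly.hom_add to_ac_poly.hom_mult)

lemma root_map_power: "root_map (p ^ n) x = root_map p x ^ n"
  by (induction n) (simp_all add: root_map_mult)

lemma root_map_prod: "root_map (prod p A) x = (\<Prod>i\<in>A. root_map (p i) x)"
  by (induction A rule: infinite_finite_induct) (simp_all add: root_map_mult)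

lemma in_root_set_iff: "x \<in> root_set p \<longleftrightarrow> root_map p x = 0"
  by (simp add: root_set_def root_map_def)

lemma root_set_nonempty:
  assumes "Polynomial.degree p > 0"
  obtains x where "x \<in> root_set p"
proof -
  have "Polynomial.degree (map_poly to_ac p) > 0" using assms by simp
  then show thesis
    using alg_closed_imp_poly_has_root that unfolding root_set_def by blast
qed

section \<open>Irreducible polynomials, common roots and separability\<close>

lemma irreducible_degree_pos:
  fixes p :: "'a::field poly"
  assumes "Factorial_Ring.irreducible p"
  shows "Polynomial.degree p > 0"
  using assms by (metis Factorial_Ring.irreducible_def gr0I is_unit_iff_degree)

lemma irreducible_dvd_imp_dvd:
  fixes a b :: "'b::algebraic_semidom"
  assumes "Factorial_Ring.irreducible a" "Factorial_Ring.irreducible b" "a dvd b"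
  shows "b dvd a"
  using assms Factorial_Ring.irreducibleD'[of b a] Factorial_Ring.irreducible_not_unit[of a] by blast

text \<open>A nonzero \<open>m\<close> of least degree vanishing at \<open>x\<close> divides, by
  division with remainder, every polynomial over the base field that vanishes at \<open>x\<close>.
  Since \<open>m\<close> is not a unit, irreducibility makes \<open>p\<close> an associate of
  \<open>m\<close>.\<close>

lemma irreducible_dvd_of_common_root:
  assumes p: "Factorial_Ring.irreducible p" and "x \<in> root_set p" and "x \<in> root_set q"
  shows "p dvd q"
proof -
  let ?I = "\<lambda>r. r \<noteq> 0 \<and> x \<in> root_set r"
  have "?I p" using assms by auto
  then obtain m where m: "?I m" and min: "\<And>r. ?I r \<Longrightarrow> Polynomial.degree m \<le> Polynomial.degree r"
    using ex_has_least_nat[of ?I p Polynomial.degree] by blast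
  have dvd: "m dvd r" if "x \<in> root_set r" for r
  proof -
    have "root_map r x = root_map m x * root_map (r div m) x + root_map (r mod m) x"
      by (metis mult_div_mod_eq root_map_add root_map_mult)
    then have "x \<in> root_set (r mod m)"
      using m that by (simp add: in_root_set_iff)
    then have "r mod m = 0"
      using min[of "r mod m"] degree_mod_less[of m r] m by fastforce
    then show ?thesis by (simp add: mod_eq_0_iff_dvd)
  qed
  obtain u where u: "p = m * u" using dvd assms(2) by (auto elim: dvdE)
  have "\<not> m dvd 1"
  proof
    assume "m dvd 1"
    then obtain v where "1 = m * v" by (rule dvdE)
    then have "1 = root_map m x * root_map v x" by (metis root_map_mult root_map_1)
    then show False using m by (simp add: in_root_set_iff)
  qed
  then have "u dvd 1" using p u Factorial_Ring.irreducibleD by blast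
  then have "p dvd m" by (simp add: u)
  then show ?thesis using dvd assms(3) dvd_trans by blast
qed

lemma card_root_set_le_degree:
  assumes "p \<noteq> 0"
  shows "card (root_set p) \<le> Polynomial.degree p"
  using card_poly_roots_bound[of "map_poly to_ac p"] assms by (simp add: root_set_def)

lemma size_proots_eq_degree:
  fixes p :: "'b::alg_closed_field poly"
  shows "size (proots p) = Polynomial.degree p"
proof (cases "p = 0")
  case False
  then obtain A where A: "size A = Polynomial.degree p"
    "p = Polynomial.smult (Polynomial.lead_coeff p) (\<Prod>x\<in>#A. [:- x, 1:])"
    using alg_closed_imp_factorization by blast
  have "proots (\<Prod>x\<in>#A. [:- x, 1:]) = A"
  proof (induction A)
    case (add x A)
    have "(\<Prod>x\<in>#A. [:- x, 1:]) \<noteq> 0" by (auto simp: prod_mset_zero_iff)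
    then show ?case using add by (simp add: proots_mult del: mult_pCons_left)
  qed simp
  then have "proots p = A" using A(2) False by (metis leading_coeff_0_iff proots_smult)
  then show ?thesis using A(1) by simp
qed simp

text \<open>Characteristic zero makes \<open>p\<close> separable: a multiple root would be shared
  with \<open>pderiv p\<close>, so \<open>p\<close> would divide a nonzero polynomial of smaller
  degree.\<close>

lemma card_root_set_irreducible:
  fixes p :: "'a::field_char_0 poly"
  assumes p: "Factorial_Ring.irreducible p"
  shows "card (root_set p) = Polynomial.degree p"
proof -
  let ?P = "map_poly to_ac p"
  have pos: "Polynomial.degree p > 0" using p by (rule irreducible_degree_pos)
  then have P0: "?P \<noteq> 0" by auto
  have pd: "pderiv ?P = map_poly to_ac (pderiv p)"
    by (simp add: to_ac.map_poly_pderiv)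
  have "rsquarefree ?P"
    unfolding rsquarefree_roots
  proof (intro allI notI)
    fix x assume x: "poly ?P x = 0 \<and> poly (pderiv ?P) x = 0"
    then have "p dvd pderiv p"
      using irreducible_dvd_of_common_root[OF p, of x "pderiv p"] by (simp add: root_set_def pd)
    then have "Polynomial.degree p \<le> Polynomial.degree (pderiv p)"
      using dvd_imp_degree_le[of p "pderiv p"] pos by (auto simp: pderiv_eq_0_iff)
    then show False using pos by (simp add: degree_pderiv)
  qed
  \<comment> \<open>Every root has order one, so the multiset of roots is just the set of roots; its
    size is the degree over an algebraically closed field.\<close>
  then have "proots ?P = mset_set (root_set p)"
    using P0 finite_root_set[of p]
    by (intro multiset_eqI)
      (auto simp: count_mset_set' root_set_def rsquarefree_root_order order_0I)
  moreover have "size (proots ?P) = Polynomial.degree ?P"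
    by (rule size_proots_eq_degree)
  ultimately show ?thesis by simp
qed

section \<open>The characteristic polynomial of multiplication by \<open>w\<close> modulo
  \<open>f\<close>\<close>

lemma dvd_mult_cancel_no_common_root:
  fixes p u h :: "'b::alg_closed_field poly"
  assumes "p \<noteq> 0" "p dvd u * h" "\<And>x. poly p x = 0 \<Longrightarrow> poly u x \<noteq> 0"
  shows "p dvd h"
  using assms
\<comment> \<open>Roots of \<open>p\<close> are stripped one at a time: each is a root of
  \<open>u * h\<close> but not of \<open>u\<close>, hence of \<open>h\<close>, and its linear factor
  cancels from both \<open>p\<close> and \<open>h\<close>.\<close>
proof (induction "Polynomial.degree p" arbitrary: p h rule: less_induct)
  case less
  show ?case
  proof (cases "Polynomial.degree p > 0")
    case False
    then have "p dvd 1" using less.prems(1) by (simp add: is_unit_iff_degree)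
    then show ?thesis using dvd_trans one_dvd by blast
  next
    case True
    then obtain x where x: "poly p x = 0" using alg_closed_imp_poly_has_root by blast
    then obtain q where q: "p = [:- x, 1:] * q" by (auto simp: poly_eq_0_iff_dvd elim: dvdE)
    have q0: "q \<noteq> 0" using q less.prems(1) by auto
    have "poly (u * h) x = 0"
      using less.prems(2) x by (metis dvd_trans poly_eq_0_iff_dvd)
    then have "poly h x = 0" using less.prems(3)[OF x] by simp
    then obtain k where k: "h = [:- x, 1:] * k" by (auto simp: poly_eq_0_iff_dvd elim: dvdE)
    have "[:- x, 1:] * q dvd [:- x, 1:] * (u * k)"
      using less.prems(2) unfolding q k by (simp only: mult.left_commute)
    then have "q dvd u * k" by (simp only: dvd_mult_cancel_left) simp
    moreover have "Polynomial.degree q < Polynomial.degree p"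
      using degree_mult_eq[of "[:- x, 1:]" q] q0 by (simp add: q del: mult_pCons_left)
    moreover have "poly u y \<noteq> 0" if "poly q y = 0" for y
      using less.prems(3)[of y] that by (simp add: q)
    ultimately have "q dvd k" using less.hyps q0 by blast
    then show ?thesis unfolding q k by (intro mult_dvd_mono) simp_all
  qed
qed

text \<open>The degree of \<open>h\<close> is too small for a multiple of \<open>p\<close>, so
  cancelling \<open>u\<close> must fail. With \<open>h\<close> read off an eigenvector and
  \<open>u = w - z\<close>, this finds a root of \<open>f\<close> where \<open>w\<close> takes the
  value \<open>z\<close>.\<close>

lemma common_root_of_dvd_mult:
  fixes p u h :: "'b::alg_closed_field poly"
  assumes "p dvd u * h" "h \<noteq> 0" "Polynomial.degree h < Polynomial.degree p"
  obtains x where "poly p x = 0" "poly u x = 0"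
proof -
  have "\<not> p dvd h" using assms(2,3) dvd_imp_degree_le leD by blast
  moreover have "p \<noteq> 0" using assms(3) by auto
  ultimately show thesis using dvd_mult_cancel_no_common_root[OF _ assms(1)] that by blast
qed

lemma exists_characteristic_polynomial:
  fixes f w :: "'a::field poly"
  assumes deg: "Polynomial.degree f > 0"
  obtains c :: "'a poly" where "Polynomial.lead_coeff c = 1" "Polynomial.degree c = Polynomial.degree f"
    "root_set c \<subseteq> root_map w ` root_set f"
proof -
  define n where "n = Polynomial.degree f"
  define r where "r j = (w * Polynomial.monom 1 j) mod f" for j
  define q where "q j = (w * Polynomial.monom 1 j) div f" for j
  \<comment> \<open>Column \<open>j\<close> lists the coefficients of \<open>w * X^j\<close> reduced
    modulo \<open>f\<close>: the matrix of multiplication by \<open>w\<close> on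
    \<open>k[x]/(f)\<close> in the basis of powers of \<open>X\<close>.\<close>
  define M where "M = Matrix.mat n n (\<lambda>(i, j). Polynomial.coeff (r j) i)"
  let ?h = "map_poly to_ac"
  have f0: "f \<noteq> 0" using deg by auto
  have M: "M \<in> carrier_mat n n" by (simp add: M_def)
  have hM: "map_mat to_ac M \<in> carrier_mat n n" using M by simp
  have "root_set (char_poly M) \<subseteq> root_map w ` root_set f"
  proof
    fix z assume "z \<in> root_set (char_poly M)"
    then have "eigenvalue (map_mat to_ac M) z"
      using eigenvalue_root_char_poly[OF hM] to_ac.char_poly_hom[OF M] by (simp add: root_set_def)
    then obtain v where v: "v \<in> carrier_vec n" "v \<noteq> 0\<^sub>v n"
      and ev: "map_mat to_ac M *\<^sub>v v = z \<cdot>\<^sub>v v"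
      using hM by (auto simp: eigenvalue_def eigenvector_def)
    \<comment> \<open>The eigenvector holds the coordinates of a residue class modulo
      \<open>f\<close>, and \<open>h\<close> is its representative of degree below
      \<open>n\<close>.\<close>
    define h where "h = (\<Sum>j<n. Polynomial.monom (v $ j) j)"
    have coeff_h: "Polynomial.coeff h i = (if i < n then v $ i else 0)" for i
      by (simp add: h_def coeff_sum)
    have "h \<noteq> 0"
    proof
      assume "h = 0"
      then have "v = 0\<^sub>v n" using coeff_h v(1) by (intro eq_vecI) (auto, metis coeff_0)
      with v(2) show False ..
    qed
    have "Polynomial.degree h < n"
      using coeff_h[of "Polynomial.degree h"] \<open>h \<noteq> 0\<close> by (auto split: if_splits)
    have wX: "?h w * Polynomial.monom 1 j = ?h f * ?h (q j) + ?h (r j)" for j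
    proof -
      have "w * Polynomial.monom 1 j = f * q j + r j" by (simp add: q_def r_def)
      then have "?h (w * Polynomial.monom 1 j) = ?h (f * q j + r j)" by simp
      then show ?thesis by (simp add: to_ac_poly.hom_add to_ac_poly.hom_mult map_poly_monom)
    qed
    \<comment> \<open>the eigenvector equation, read as an identity of remainders modulo \<open>f\<close>\<close>
    have sum_r: "(\<Sum>j<n. Polynomial.smult (v $ j) (?h (r j))) = Polynomial.smult z h"
    proof (rule poly_eqI)
      fix i
      have "Polynomial.coeff (\<Sum>j<n. Polynomial.smult (v $ j) (?h (r j))) i
          = (\<Sum>j<n. to_ac (Polynomial.coeff (r j) i) * v $ j)"
        by (simp add: coeff_sum mult.commute)
      also have "\<dots> = Polynomial.coeff (Polynomial.smult z h) i"
      proof (cases "i < n")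
        case True
        have "(\<Sum>j<n. to_ac (Polynomial.coeff (r j) i) * v $ j) = (map_mat to_ac M *\<^sub>v v) $ i"
          using True v(1) by (simp add: M_def scalar_prod_def atLeast0LessThan)
        then show ?thesis using True v(1) by (simp add: ev coeff_h)
      next
        case False
        have "Polynomial.coeff (r j) i = 0" for j
          using False degree_mod_less[OF f0, of "w * Polynomial.monom 1 j"]
          by (auto simp: r_def n_def coeff_eq_0)
        then show ?thesis using False by (simp add: coeff_h)
      qed
      finally show "Polynomial.coeff (\<Sum>j<n. Polynomial.smult (v $ j) (?h (r j))) i
          = Polynomial.coeff (Polynomial.smult z h) i" .
    qed
    have "?h w * h = (\<Sum>j<n. Polynomial.smult (v $ j) (?h w * Polynomial.monom 1 j))"
      by (simp add: h_def sum_distrib_left smult_monom flip: mult_smult_right)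
    also have "\<dots> = (\<Sum>j<n. ?h f * Polynomial.smult (v $ j) (?h (q j))) + Polynomial.smult z h"
      by (simp only: wX smult_add_right sum.distrib sum_r mult_smult_right)
    also have "\<dots> = ?h f * (\<Sum>j<n. Polynomial.smult (v $ j) (?h (q j))) + [:z:] * h"
      by (simp add: sum_distrib_left)
    finally have "(?h w - [:z:]) * h = ?h f * (\<Sum>j<n. Polynomial.smult (v $ j) (?h (q j)))"
      by (simp only: left_diff_distrib) simp
    then have "?h f dvd (?h w - [:z:]) * h" by simp
    then obtain x where "poly (?h f) x = 0" "poly (?h w - [:z:]) x = 0"
      using common_root_of_dvd_mult[of "?h f" "?h w - [:z:]" h] \<open>h \<noteq> 0\<close> \<open>Polynomial.degree h < n\<close>
      by (auto simp: n_def)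
    then show "z \<in> root_map w ` root_set f"
      by (intro image_eqI[of _ _ x]) (auto simp: root_map_def root_set_def)
  qed
  then show thesis
    using that[of "char_poly M"] degree_monic_char_poly[OF M] by (simp add: n_def)
qed

section \<open>The minimal polynomial of the values of \<open>w\<close> at the roots of an
  irreducible \<open>f\<close>\<close>

lemma exists_minimal_polynomial_of_image:
  fixes f w :: "'a::field poly"
  assumes f: "Factorial_Ring.irreducible f"
  obtains g where "Factorial_Ring.irreducible g" "Polynomial.lead_coeff g = 1"
    "Polynomial.degree g dvd Polynomial.degree f"
    "root_set g = root_map w ` root_set f" "f dvd pcompose g w"
proof -
  obtain c where c: "Polynomial.lead_coeff c = 1" "Polynomial.degree c = Polynomial.degree f"
    and roots: "root_set c \<subseteq> root_map w ` root_set f"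
    using exists_characteristic_polynomial[of f w] irreducible_degree_pos[OF f] by blast
  obtain S e where S: "finite S" "c = (\<Prod>a\<in>S. a ^ Suc (e a))"
    "S \<subseteq> {a. Factorial_Ring.irreducible a \<and> Polynomial.lead_coeff a = 1}"
    using monic_irreducible_factorization[OF c(1)] by blast
  obtain x0 where x0: "x0 \<in> root_set f"
    using root_set_nonempty irreducible_degree_pos[OF f] by blast
  have root_c: "root_set a \<subseteq> root_set c" if "a \<in> S" for a
    using that S(1) by (auto simp: S(2) in_root_set_iff root_map_prod root_map_power root_map_mult)
  \<comment> \<open>A single root of \<open>a\<close> of the form \<open>w(x)\<close> suffices: then
    \<open>pcompose a w\<close> shares the root \<open>x\<close> with the irreducible
    \<open>f\<close>.\<close>
  have dvd: "f dvd pcompose a w" if a: "a \<in> S" for a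
  proof -
    obtain z where "z \<in> root_set a"
      using a S(3) root_set_nonempty[of a] irreducible_degree_pos[of a] by blast
    moreover from this obtain x where "x \<in> root_set f" "z = root_map w x"
      using root_c[OF a] roots by blast
    ultimately show ?thesis
      using irreducible_dvd_of_common_root[OF f, of x "pcompose a w"]
      by (simp add: in_root_set_iff root_map_pcompose)
  qed
  have im: "root_map w ` root_set f \<subseteq> root_set a" if "a \<in> S" for a
    using morphism_root_map[OF dvd[OF that]] by (auto simp: morphism_over_base_def)
  have "Polynomial.degree c > 0" using c(2) irreducible_degree_pos[OF f] by simp
  then have "S \<noteq> {}" using S(2) by auto
  then obtain g where g: "g \<in> S" by blast
  \<comment> \<open>All factors vanish at the same point \<open>root_map w x0\<close>, and monic
    irreducible polynomials with a common root coincide.\<close>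
  have "a = g" if "a \<in> S" for a
  proof -
    have "root_map w x0 \<in> root_set a" "root_map w x0 \<in> root_set g" using im x0 that g by blast+
    then have "a dvd g" "g dvd a" using irreducible_dvd_of_common_root S(3) that g by blast+
    moreover have "Polynomial.lead_coeff a = 1" "Polynomial.lead_coeff g = 1" using S(3) that g by blast+
    ultimately show ?thesis by (intro poly_dvd_antisym) simp_all
  qed
  then have "S = {g}" using g by blast
  then have "c = g ^ Suc (e g)" using S(2) by simp
  \<comment> \<open>As \<open>c\<close> has the degree of \<open>f\<close>, this is the source of
    the divisibility of degrees.\<close>
  then have "Polynomial.degree c = Suc (e g) * Polynomial.degree g"
    using S(3) g degree_power_eq[of g "Suc (e g)"] by fastforce
  then show thesis
    using that[of g] S(3) g c(2) im[OF g] root_c[OF g] roots dvd[OF g] by auto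
qed

text \<open>By separability the degree of \<open>g\<close> is exactly its number of roots, and a
  non-injective image of \<open>root_set f\<close> has fewer points than
  \<open>root_set f\<close>.\<close>

lemma degree_less_if_not_inj_on:
  fixes f g :: "'a::field_char_0 poly"
  assumes "f \<noteq> 0" "Factorial_Ring.irreducible g" "root_set g = h ` root_set f" "\<not> inj_on h (root_set f)"
  shows "Polynomial.degree g < Polynomial.degree f"
proof -
  have fin: "finite (root_set f)" using assms(1) by (rule finite_root_set)
  have "Polynomial.degree g = card (h ` root_set f)"
    using card_root_set_irreducible[OF assms(2)] assms(3) by simp
  also have "\<dots> < card (root_set f)"
    using fin assms(4) card_image_le[OF fin, of h] eq_card_imp_inj_on[OF fin, of h] by linarith
  also have "\<dots> \<le> Polynomial.degree f" using assms(1) by (rule card_root_set_le_degree)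
  finally show ?thesis .
qed

section \<open>Products of prime powers and the degree count\<close>

lemma prime_elem_dvd_prodE:
  fixes p :: "'b::algebraic_semidom"
  assumes "finite A" "prime_elem p" "p dvd prod f A"
  obtains x where "x \<in> A" "p dvd f x"
proof -
  have "\<exists>x\<in>A. p dvd f x"
    using assms(1,3)
  proof (induction A rule: finite_induct)
    case empty
    then show ?case using assms(2) by (simp add: prime_elem_not_unit)
  next
    case (insert x A)
    then show ?case using assms(2) by (auto simp: prime_elem_dvd_mult_iff)
  qed
  then show thesis using that by blast
qed

text \<open>The third assumption keeps distinct members from dividing one another, so a new prime
  does not divide the product already split off from \<open>h\<close>, and its full power passes to
  the cofactor.\<close>

lemma prod_prime_power_dvd:
  fixes h :: "'b::algebraic_semidom"
  assumes "finite S" "\<And>a. a \<in> S \<Longrightarrow> prime_elem a"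
    and "\<And>a b. a \<in> S \<Longrightarrow> b \<in> S \<Longrightarrow> a dvd b \<Longrightarrow> a = b"
    and "\<And>a. a \<in> S \<Longrightarrow> a ^ e a dvd h"
  shows "(\<Prod>a\<in>S. a ^ e a) dvd h"
  using assms
proof (induction S rule: finite_induct)
  case (insert a S)
  have "(\<Prod>b\<in>S. b ^ e b) dvd h" using insert by blast
  then obtain t where t: "h = (\<Prod>b\<in>S. b ^ e b) * t" by (rule dvdE)
  have ndvd: "\<not> a dvd (\<Prod>b\<in>S. b ^ e b)"
  proof
    assume "a dvd (\<Prod>b\<in>S. b ^ e b)"
    then obtain b where "b \<in> S" "a dvd b ^ e b"
      using prime_elem_dvd_prodE[of S a "\<lambda>b. b ^ e b"] insert by blast
    then have "a dvd b" using insert.prems(1)[of a] prime_elem_dvd_power by blast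
    then show False using insert.prems(2)[of a b] insert.hyps \<open>b \<in> S\<close> by auto
  qed
  have "a ^ e a dvd t"
  proof (cases "e a = 0")
    case False
    show ?thesis
    proof (rule prime_power_dvd_multD)
      show "a ^ e a dvd (\<Prod>b\<in>S. b ^ e b) * t" unfolding t [symmetric] using insert.prems by blast
    qed (use False ndvd insert.prems in auto)
  qed simp
  then have "a ^ e a * (\<Prod>b\<in>S. b ^ e b) dvd t * (\<Prod>b\<in>S. b ^ e b)"
    by (rule mult_dvd_mono) simp
  then show ?case using insert.hyps by (simp add: t mult.commute)
qed simp

text \<open>The degree comparison in abstract form: \<open>k\<close> and \<open>d\<close> are
  multiplicities and degrees of the factors of \<open>f\<close>, \<open>m\<close> sends a factor to
  its image polynomial, and \<open>d'\<close> is the degree of the latter. The maximum over a fibre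
  is attained by one member, whose own term already bounds the contribution of that fibre.\<close>

lemma sum_Max_fibres_less:
  fixes k d :: "'a \<Rightarrow> nat" and d' :: "'b \<Rightarrow> nat"
  assumes S: "finite S" and le: "\<And>a. a \<in> S \<Longrightarrow> d' (m a) \<le> d a"
    and pos: "\<And>a. a \<in> S \<Longrightarrow> 0 < k a" "\<And>a. a \<in> S \<Longrightarrow> 0 < d a"
    and xy: "x \<in> S" "y \<in> S" "m x = m y" "x \<noteq> y \<or> d' (m x) < d x"
  shows "(\<Sum>b\<in>m ` S. Max (k ` {a\<in>S. m a = b}) * d' b) < (\<Sum>a\<in>S. k a * d a)"
proof -
  let ?F = "\<lambda>b. {a\<in>S. m a = b}"
  have Max_in: "\<exists>a\<in>?F b. Max (k ` ?F b) = k a" if "b \<in> m ` S" for b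
  proof -
    have "Max (k ` ?F b) \<in> k ` ?F b" using S that by (intro Max_in) auto
    then show ?thesis by blast
  qed
  have "Max (k ` ?F b) * d' b \<le> (\<Sum>a\<in>?F b. k a * d a)" if b: "b \<in> m ` S" for b
  proof -
    obtain a where a: "a \<in> ?F b" "Max (k ` ?F b) = k a" using Max_in[OF b] by blast
    then have "Max (k ` ?F b) * d' b \<le> k a * d a" using le[of a] by auto
    also have "\<dots> \<le> (\<Sum>a\<in>?F b. k a * d a)" using S a(1) by (intro member_le_sum) auto
    finally show ?thesis .
  qed
  moreover have "Max (k ` ?F (m x)) * d' (m x) < (\<Sum>a\<in>?F (m x). k a * d a)"
  proof -
    obtain a where a: "a \<in> ?F (m x)" "Max (k ` ?F (m x)) = k a" using Max_in[of "m x"] xy(1) by blast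
    have a_le: "k a * d' (m x) \<le> k a * d a" using a(1) le[of a] by auto
    show ?thesis
    proof (cases "a = x \<and> x = y")
      case True
      then have "k a * d' (m x) < k a * d a" using xy(4) pos(1)[OF xy(1)] by simp
      also have "\<dots> \<le> (\<Sum>a\<in>?F (m x). k a * d a)" using S a(1) by (intro member_le_sum) auto
      finally show ?thesis by (simp add: a(2))
    next
      case False
      \<comment> \<open>The fibre has a member besides the maximiser \<open>a\<close>:
        \<open>y\<close> if \<open>a = x\<close>, and \<open>x\<close> otherwise. Its positive term
        makes the inequality strict.\<close>
      then obtain c where c: "c \<in> ?F (m x)" "c \<noteq> a" using xy by (cases "a = x") auto
      have "0 < k c * d c" using c(1) pos by simp
      then have "k a * d' (m x) < k a * d a + k c * d c" using a_le by linarith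
      also have "\<dots> = (\<Sum>a\<in>{a, c}. k a * d a)" using c(2) by simp
      also have "\<dots> \<le> (\<Sum>a\<in>?F (m x). k a * d a)"
        using S a(1) c(1) by (intro sum_mono2) auto
      finally show ?thesis by (simp add: a(2))
    qed
  qed
  ultimately have "(\<Sum>b\<in>m ` S. Max (k ` ?F b) * d' b) < (\<Sum>b\<in>m ` S. \<Sum>a\<in>?F b. k a * d a)"
    using S xy(1) by (intro sum_strict_mono_ex1) auto
  also have "\<dots> = (\<Sum>a\<in>S. k a * d a)"
    using sum.image_gen[OF S, of "\<lambda>a. k a * d a" m] by simp
  finally show ?thesis .
qed

lemma degree_prod_power:
  fixes S :: "'a::idom poly set"
  assumes "\<And>a. a \<in> S \<Longrightarrow> a \<noteq> 0"
  shows "Polynomial.degree (\<Prod>a\<in>S. a ^ k a) = (\<Sum>a\<in>S. k a * Polynomial.degree a)"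
  using assms by (simp add: degree_prod_eq_sum_degree degree_power_eq mult.commute)

lemma pcompose_power: "pcompose (p ^ n) q = pcompose p q ^ n"
  by (induction n) (simp_all add: pcompose_mult)

lemma root_set_prod_power:
  assumes "finite S" "\<And>a. a \<in> S \<Longrightarrow> k a > 0"
  shows "root_set (\<Prod>a\<in>S. a ^ k a) = (\<Union>a\<in>S. root_set a)"
  using assms by (auto simp: in_root_set_iff root_map_prod root_map_power)

section \<open>Construction of \<open>g\<close> from the factorization of \<open>f\<close>\<close>

theorem theorem2:
  fixes f \<omega> :: "'k::field_char_0 poly"
    and \<gamma> :: "'k alg_closure \<Rightarrow>\<^sub>0 int"
  assumes "f \<noteq> 0"
    and "\<gamma> \<in> simple_cycles (root_set f)"
    and "cycle_integral \<gamma> \<omega> = 0"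
  shows "\<exists>g::'k poly. g \<noteq> 0 \<and>
           Polynomial.degree g < Polynomial.degree f \<and>
           (\<forall>p. Factorial_Ring.irreducible p \<and> p dvd g \<longrightarrow>
             (\<exists>q. Factorial_Ring.irreducible q \<and> q dvd f \<and>
                  Polynomial.degree p dvd Polynomial.degree q)) \<and>
           f dvd pcompose g \<omega> \<and>
           morphism_over_base (root_set f) (root_set g) (root_map \<omega>) \<and>
           root_map \<omega> ` root_set f = root_set g \<and>
           push_cycle (root_map \<omega>) \<gamma> = 0"
proof -
  obtain x y where \<gamma>: "\<gamma> = frag_of x - frag_of y"
    and xy: "x \<in> root_set f" "y \<in> root_set f" "x \<noteq> y"
    using assms(2) unfolding simple_cycles_eq by blast
  have \<omega>xy: "root_map \<omega> x = root_map \<omega> y"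
    using assms(3) cycle_integral_simple[OF xy(3), of \<omega>] by (simp add: \<gamma> root_map_def)

  \<comment> \<open>Normalised to be monic, as the factorization into monic irreducibles requires;
    roots, degree and divisibility are unaffected.\<close>
  define F where "F = Polynomial.smult (inverse (Polynomial.lead_coeff f)) f"
  have F: "F dvd f" "f dvd F" "Polynomial.degree F = Polynomial.degree f" "Polynomial.lead_coeff F = 1"
    using assms(1) by (simp_all add: F_def smult_dvd_iff dvd_smult_iff)
  have root_F: "root_set F = root_set f"
    using assms(1) by (auto simp: F_def root_set_def to_ac.map_poly_hom_smult)
  obtain S e where S: "finite S" and F_prod: "F = (\<Prod>a\<in>S. a ^ Suc (e a))"
    and S_irr: "S \<subseteq> {a. Factorial_Ring.irreducible a \<and> Polynomial.lead_coeff a = 1}"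
    using monic_irreducible_factorization[OF F(4)] by blast
  have "\<forall>a\<in>S. \<exists>g. Factorial_Ring.irreducible g \<and> Polynomial.lead_coeff g = 1 \<and>
      Polynomial.degree g dvd Polynomial.degree a \<and>
      root_set g = root_map \<omega> ` root_set a \<and> a dvd pcompose g \<omega>"
    using exists_minimal_polynomial_of_image S_irr by (metis (no_types, lifting) mem_Collect_eq subset_eq)
  then obtain m where m: "\<And>a. a \<in> S \<Longrightarrow> Factorial_Ring.irreducible (m a)"
      "\<And>a. a \<in> S \<Longrightarrow> Polynomial.lead_coeff (m a) = 1"
      "\<And>a. a \<in> S \<Longrightarrow> Polynomial.degree (m a) dvd Polynomial.degree a"
      "\<And>a. a \<in> S \<Longrightarrow> root_set (m a) = root_map \<omega> ` root_set a"
      "\<And>a. a \<in> S \<Longrightarrow> a dvd pcompose (m a) \<omega>"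
    by (auto dest!: bchoice)

  \<comment> \<open>The maximum covers the multiplicity of every factor above \<open>b\<close>.
    Adding the multiplicities instead could leave the degree unchanged when factors with equal
    \<open>m a\<close> merge without a drop in their degrees.\<close>
  define K where "K b = Max ((\<lambda>a. Suc (e a)) ` {a \<in> S. m a = b})" for b
  define g where "g = (\<Prod>b\<in>m ` S. b ^ K b)"
  have K_ge: "Suc (e a) \<le> K (m a)" if "a \<in> S" for a
    using that S unfolding K_def by (intro Max_ge) auto
  have K_pos: "K b > 0" if "b \<in> m ` S" for b
    using that K_ge by fastforce
  have m0: "b \<noteq> 0" if "b \<in> m ` S" for b using that m(1) by fastforce
  have g0: "g \<noteq> 0" using S m0 by (auto simp: g_def)
  have S0: "a \<noteq> 0" if "a \<in> S" for a using that S_irr by fastforce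
  have deg_pos: "Polynomial.degree a > 0" if "a \<in> S" for a
    using that S_irr irreducible_degree_pos by blast

  have roots_S: "root_set f = (\<Union>a\<in>S. root_set a)"
    using root_set_prod_power[OF S, of "\<lambda>a. Suc (e a)"] root_F F_prod by simp
  then obtain a b where ab: "a \<in> S" "b \<in> S" "x \<in> root_set a" "y \<in> root_set b"
    using xy by blast
  have "root_map \<omega> x \<in> root_set (m a)" using ab(1,3) m(4) by simp
  moreover have "root_map \<omega> x \<in> root_set (m b)" using ab(2,4) m(4) \<omega>xy by simp
  ultimately have "m a dvd m b" "m b dvd m a"
    using irreducible_dvd_of_common_root m(1) ab by blast+
  then have mab: "m a = m b" using m(2) ab by (intro poly_dvd_antisym) auto
  \<comment> \<open>Either two factors merge, or \<omega> identifies two roots of one factor; each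
    alternative gives the strict inequality in the fibre of \<open>m a\<close>.\<close>
  have strict: "a \<noteq> b \<or> Polynomial.degree (m a) < Polynomial.degree a"
  proof (cases "a = b")
    case True
    then have "\<not> inj_on (root_map \<omega>) (root_set a)" using ab xy(3) \<omega>xy by (auto simp: inj_on_def)
    then show ?thesis using degree_less_if_not_inj_on[of a "m a"] S0 m(1,4) ab(1) by blast
  qed simp
  have "Polynomial.degree g < Polynomial.degree F"
  proof -
    have "Polynomial.degree g = (\<Sum>b\<in>m ` S. K b * Polynomial.degree b)"
      unfolding g_def by (rule degree_prod_power) (rule m0)
    also have "\<dots> < (\<Sum>a\<in>S. Suc (e a) * Polynomial.degree a)"
      unfolding K_def
      by (rule sum_Max_fibres_less[OF S, where x = a and y = b])
        (use ab(1,2) mab strict deg_pos m(3) in \<open>auto intro: dvd_imp_le\<close>)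
    also have "\<dots> = Polynomial.degree F"
      unfolding F_prod by (rule degree_prod_power [symmetric]) (rule S0)
    finally show ?thesis .
  qed
  then have deg: "Polynomial.degree g < Polynomial.degree f" by (simp add: F(3))

  have factors: "\<exists>q. Factorial_Ring.irreducible q \<and> q dvd f \<and> Polynomial.degree p dvd Polynomial.degree q"
    if p: "Factorial_Ring.irreducible p" "p dvd g" for p
  proof -
    \<comment> \<open>Primality places \<open>p\<close> below some \<open>m a\<close>; both being
      irreducible, they are associates and have equal degree.\<close>
    have prime: "prime_elem p" using p(1) by (rule field_poly_irreducible_imp_prime)
    obtain b where b: "b \<in> m ` S" "p dvd b ^ K b"
      using prime_elem_dvd_prodE[OF _ prime p(2)[unfolded g_def]] S by blast
    then obtain a where a: "a \<in> S" "b = m a" by blast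
    have "p dvd m a" using b(2) a(2) prime prime_elem_dvd_power by blast
    then have "m a dvd p" using irreducible_dvd_imp_dvd[OF p(1) m(1)[OF a(1)]] by blast
    then have "Polynomial.degree p = Polynomial.degree (m a)"
      using \<open>p dvd m a\<close> dvd_imp_degree_le[of p "m a"] dvd_imp_degree_le[of "m a" p] m0[of "m a"] a(1)
      by fastforce
    moreover have "a dvd F"
      using S a(1) unfolding F_prod by (meson dvd_power dvd_prodI dvd_trans zero_less_Suc)
    ultimately have "a dvd f" "Polynomial.degree p dvd Polynomial.degree a"
      using m(3)[OF a(1)] F(1) dvd_trans[of a F f] by simp_all
    then show ?thesis using S_irr a(1) by blast
  qed

  have "F dvd pcompose g \<omega>"
    unfolding F_prod
  proof (rule prod_prime_power_dvd[OF S])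
    show "prime_elem a" if "a \<in> S" for a
      using that S_irr field_poly_irreducible_imp_prime by blast
    show "a = b" if "a \<in> S" "b \<in> S" "a dvd b" for a b
    proof -
      have "b dvd a" using irreducible_dvd_imp_dvd[of a b] that S_irr by blast
      moreover have "Polynomial.lead_coeff a = 1" "Polynomial.lead_coeff b = 1" using S_irr that by blast+
      ultimately show ?thesis using that(3) by (intro poly_dvd_antisym) simp_all
    qed
    show "a ^ Suc (e a) dvd pcompose g \<omega>" if a: "a \<in> S" for a
    proof -
      \<comment> \<open>Since \<open>a\<close> divides \<open>pcompose (m a) \<omega>\<close>,
        raising to the power \<open>K (m a)\<close> accounts for the whole multiplicity of
        \<open>a\<close> in \<open>F\<close>.\<close>
      have "a ^ Suc (e a) dvd pcompose (m a) \<omega> ^ K (m a)"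
        using m(5)[OF a] K_ge[OF a] by (rule dvd_power_le)
      also have "\<dots> dvd pcompose g \<omega>"
        unfolding g_def pcompose_prod pcompose_power using S a by (intro dvd_prodI) auto
      finally show ?thesis .
    qed
  qed
  then have dvd: "f dvd pcompose g \<omega>" using F(2) dvd_trans by blast

  have "root_map \<omega> ` root_set f = root_set g"
    using root_set_prod_power[of "m ` S" K] S K_pos m(4) by (simp add: g_def roots_S image_UN)
  moreover have "push_cycle (root_map \<omega>) \<gamma> = 0"
    by (simp add: \<gamma> push_cycle_simple \<omega>xy)
  ultimately show ?thesis
    using g0 deg factors dvd morphism_root_map[OF dvd] by blast
qed

end
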